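(* Suppose that $R$ is a semipotent ring. Then $R$ is a CUNC-ring if and only if $R$ is a CUC-ring and $J(R)$ is nil.
   Context: All rings are associative with identity (not necessarily commutative). $U(R)$, $J(R)$, $\mathrm{nil}(R)$, $\mathrm{idem}(R)$ denote the group of units, the Jacobson radical, the set of nilpotents and the set of idempotents of $R$. An element $r\in R$ is clean if $r=u+e$ for some $u\in U(R)$ and $e\in\mathrm{idem}(R)$; it is uniquely clean if there is exactly one such pair $(u,e)\in U(R)\times\mathrm{idem}(R)$. An element $r\in R$ is uniquely nil-clean if there is exactly one pair $(q,e)\in\mathrm{nil}(R)\times\mathrm{idem}(R)$ with $r=q+e$. $R$ is a CUNC-ring if every clean element of $R$ is uniquely nil-clean. $R$ is a CUC-ring if every clean element of $R$ is uniquely clean. $R$ is semipotent if every one-sided ideal of $R$ not contained in $J(R)$ contains a non-zero idempotent. An ideal is nil if all its elements are nilpotent. *)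

theory Defs
  imports "HOL-Algebra.Algebra"
begin

definition left_ideal :: "'a set \<Rightarrow> ('a, 'b) ring_scheme \<Rightarrow> bool" where
  "left_ideal I R \<longleftrightarrow>
     additive_subgroup I R \<and> (\<forall>a\<in>I. \<forall>x\<in>carrier R. x \<otimes>\<^bsub>R\<^esub> a \<in> I)"

definition right_ideal :: "'a set \<Rightarrow> ('a, 'b) ring_scheme \<Rightarrow> bool" where
  "right_ideal I R \<longleftrightarrow>
     additive_subgroup I R \<and> (\<forall>a\<in>I. \<forall>x\<in>carrier R. a \<otimes>\<^bsub>R\<^esub> x \<in> I)"

definition maximal_left_ideal :: "'a set \<Rightarrow> ('a, 'b) ring_scheme \<Rightarrow> bool" where
  "maximal_left_ideal M R \<longleftrightarrow>
     left_ideal M R \<and> M \<noteq> carrier R \<and>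
     (\<forall>I. left_ideal I R \<longrightarrow> M \<subseteq> I \<longrightarrow> I = M \<or> I = carrier R)"

text \<open>The intersection with the carrier only matters for the zero ring, which has no maximal
  left ideals; its radical is the whole ring.\<close>

definition jacobson_radical :: "('a, 'b) ring_scheme \<Rightarrow> 'a set" where
  "jacobson_radical R = carrier R \<inter> \<Inter>{M. maximal_left_ideal M R}"

definition nilpotents :: "('a, 'b) ring_scheme \<Rightarrow> 'a set" where
  "nilpotents R = {q \<in> carrier R. \<exists>n::nat. q [^]\<^bsub>R\<^esub> n = \<zero>\<^bsub>R\<^esub>}"

definition idempotents :: "('a, 'b) ring_scheme \<Rightarrow> 'a set" where
  "idempotents R = {e \<in> carrier R. e \<otimes>\<^bsub>R\<^esub> e = e}"

definition clean :: "('a, 'b) ring_scheme \<Rightarrow> 'a \<Rightarrow> bool" where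
  "clean R r \<longleftrightarrow> (\<exists>u\<in>Units R. \<exists>e\<in>idempotents R. r = u \<oplus>\<^bsub>R\<^esub> e)"

definition uniquely_clean :: "('a, 'b) ring_scheme \<Rightarrow> 'a \<Rightarrow> bool" where
  "uniquely_clean R r \<longleftrightarrow>
     (\<exists>!p. p \<in> Units R \<times> idempotents R \<and> r = fst p \<oplus>\<^bsub>R\<^esub> snd p)"

definition uniquely_nil_clean :: "('a, 'b) ring_scheme \<Rightarrow> 'a \<Rightarrow> bool" where
  "uniquely_nil_clean R r \<longleftrightarrow>
     (\<exists>!p. p \<in> nilpotents R \<times> idempotents R \<and> r = fst p \<oplus>\<^bsub>R\<^esub> snd p)"

definition CUNC_ring :: "('a, 'b) ring_scheme \<Rightarrow> bool" where
  "CUNC_ring R \<longleftrightarrow> ring R \<and> (\<forall>r\<in>carrier R. clean R r \<longrightarrow> uniquely_nil_clean R r)"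

definition CUC_ring :: "('a, 'b) ring_scheme \<Rightarrow> bool" where
  "CUC_ring R \<longleftrightarrow> ring R \<and> (\<forall>r\<in>carrier R. clean R r \<longrightarrow> uniquely_clean R r)"

definition semipotent_ring :: "('a, 'b) ring_scheme \<Rightarrow> bool" where
  "semipotent_ring R \<longleftrightarrow> ring R \<and>
     (\<forall>I. left_ideal I R \<or> right_ideal I R \<longrightarrow> \<not> I \<subseteq> jacobson_radical R \<longrightarrow>
        (\<exists>e\<in>idempotents R. e \<in> I \<and> e \<noteq> \<zero>\<^bsub>R\<^esub>))"

definition nil_subset :: "'a set \<Rightarrow> ('a, 'b) ring_scheme \<Rightarrow> bool" where
  "nil_subset I R \<longleftrightarrow> I \<subseteq> nilpotents R"

end

theory Submission
  imports Defs
begin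

text \<open>
  Both sides of the equivalence force idempotents to be central: for idempotents \<open>e\<close>, \<open>f\<close> with
  \<open>ef + fe = e + f\<close> (for instance \<open>f = e + er(1 - e)\<close>), the element \<open>e + f - 1\<close> is an
  involution and \<open>e - f\<close> squares to zero, so \<open>e = (e + f - 1) + (1 - f)\<close> and
  \<open>e = (e - f) + f\<close> compete with the decompositions in which \<open>f\<close> is replaced by \<open>e\<close>.

  If idempotents are central and units are uniquely nil-clean, then every unit is \<open>1 + q\<close> with
  \<open>q\<close> nilpotent; since \<open>1 + J(R)\<close> consists of units, \<open>J(R)\<close> is nil, and clean decompositions of
  \<open>r\<close> become nil-clean decompositions of \<open>r - 1\<close>. Conversely, if \<open>u\<close> is a unit of a semipotent
  CUC-ring with \<open>1 - u \<notin> J(R)\<close>, pick an idempotent \<open>0 \<noteq> e = r(1 - u)\<close>. Then \<open>(1 - u)e\<close> is a unit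
  of the corner \<open>eR\<close>, and \<open>ue + (1 - e)\<close> has the clean decompositions with idempotents \<open>0\<close> and
  \<open>e\<close>, a contradiction. So all units lie in \<open>1 + J(R)\<close>, and
  \<open>u + e = (1 - e) + ((u - 1) + 2e)\<close> with \<open>2 \<in> J(R)\<close> is nil-clean; uniqueness holds because adding
  \<open>1\<close> turns a nil-clean decomposition into a clean one.
\<close>

context ring
begin

section \<open>Idempotents, nilpotents and uniqueness of decompositions\<close>

lemma idempotents_carrier: "e \<in> idempotents R \<Longrightarrow> e \<in> carrier R"
  and nilpotents_carrier: "q \<in> nilpotents R \<Longrightarrow> q \<in> carrier R"
  by (auto simp: idempotents_def nilpotents_def)

lemma zero_idempotent: "\<zero> \<in> idempotents R"
  by (simp add: idempotents_def)

lemma one_minus_idempotent: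
  assumes "e \<in> idempotents R"
  shows "\<one> \<ominus> e \<in> idempotents R"
proof -
  have "e \<in> carrier R" "e \<otimes> e = e"
    using assms by (auto simp: idempotents_def)
  then have "(\<one> \<ominus> e) \<otimes> (\<one> \<ominus> e) = \<one> \<ominus> e"
    by (algebra; simp)
  with \<open>e \<in> carrier R\<close> show ?thesis
    by (simp add: idempotents_def)
qed

lemma nilpotentI_square_zero:
  assumes "q \<in> carrier R" "q \<otimes> q = \<zero>"
  shows "q \<in> nilpotents R"
proof -
  have "q [^] (2::nat) = \<zero>"
    using assms by (simp add: numeral_2_eq_2)
  with assms(1) show ?thesis
    by (auto simp: nilpotents_def)
qed

lemma zero_nilpotent: "\<zero> \<in> nilpotents R"
  by (simp add: nilpotentI_square_zero)

lemma uniquely_cleanD: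
  assumes "uniquely_clean R r" "u \<in> Units R" "e \<in> idempotents R" "r = u \<oplus> e"
    "v \<in> Units R" "f \<in> idempotents R" "r = v \<oplus> f"
  shows "u = v" "e = f"
  using assms unfolding uniquely_clean_def
  by (metis (no_types, lifting) SigmaI fst_conv snd_conv)+

lemma uniquely_nil_cleanD:
  assumes "uniquely_nil_clean R r" "p \<in> nilpotents R" "e \<in> idempotents R" "r = p \<oplus> e"
    "q \<in> nilpotents R" "f \<in> idempotents R" "r = q \<oplus> f"
  shows "p = q" "e = f"
  using assms unfolding uniquely_nil_clean_def
  by (metis (no_types, lifting) SigmaI fst_conv snd_conv)+

text \<open>Additive cancellation recovers the unit from \<open>r\<close> and the idempotent, so
  only the idempotents of two decompositions need to be compared.\<close>

lemma uniquely_cleanI: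
  assumes "clean R r"
    and "\<And>u e v f. \<lbrakk>u \<in> Units R; e \<in> idempotents R; r = u \<oplus> e;
      v \<in> Units R; f \<in> idempotents R; r = v \<oplus> f\<rbrakk> \<Longrightarrow> e = f"
  shows "uniquely_clean R r"
proof -
  obtain u e where ue: "u \<in> Units R" "e \<in> idempotents R" "r = u \<oplus> e"
    using assms(1) by (auto simp: clean_def)
  show ?thesis
    unfolding uniquely_clean_def
  proof (rule ex1I)
    show "(u, e) \<in> Units R \<times> idempotents R \<and> r = fst (u, e) \<oplus> snd (u, e)"
      using ue by simp
  next
    fix p
    assume p: "p \<in> Units R \<times> idempotents R \<and> r = fst p \<oplus> snd p"
    then have "snd p = e"
      using assms(2)[of "fst p" "snd p" u e] ue by auto
    moreover from this have "fst p = u"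
      using p ue by (auto simp: Units_closed idempotents_carrier)
    ultimately show "p = (u, e)"
      by (simp add: prod_eq_iff)
  qed
qed

lemma uniquely_nil_cleanI:
  assumes "q \<in> nilpotents R" "e \<in> idempotents R" "r = q \<oplus> e"
    and "\<And>p f. \<lbrakk>p \<in> nilpotents R; f \<in> idempotents R; r = p \<oplus> f\<rbrakk> \<Longrightarrow> f = e"
  shows "uniquely_nil_clean R r"
  unfolding uniquely_nil_clean_def
proof (rule ex1I)
  show "(q, e) \<in> nilpotents R \<times> idempotents R \<and> r = fst (q, e) \<oplus> snd (q, e)"
    using assms by simp
next
  fix x
  assume x: "x \<in> nilpotents R \<times> idempotents R \<and> r = fst x \<oplus> snd x"
  then have "snd x = e"
    using assms(4)[of "fst x" "snd x"] by auto
  moreover from this have "fst x = q"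
    using x assms(1-3) by (auto simp: nilpotents_carrier idempotents_carrier)
  ultimately show "x = (q, e)"
    by (simp add: prod_eq_iff)
qed

lemma uniquely_nil_clean_if_CUNC:
  assumes "CUNC_ring R" "u \<in> Units R" "e \<in> idempotents R"
  shows "uniquely_nil_clean R (u \<oplus> e)"
  using assms unfolding CUNC_ring_def clean_def
  by (metis a_closed Units_closed idempotents_carrier)

lemma uniquely_clean_if_CUC:
  assumes "CUC_ring R" "u \<in> Units R" "e \<in> idempotents R"
  shows "uniquely_clean R (u \<oplus> e)"
  using assms unfolding CUC_ring_def clean_def
  by (metis a_closed Units_closed idempotents_carrier)

section \<open>Centrality of idempotents\<close>

lemma add_minus_one_unit:
  assumes "e \<in> idempotents R" "f \<in> idempotents R" "e \<otimes> f \<oplus> f \<otimes> e = e \<oplus> f"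
  shows "e \<oplus> f \<ominus> \<one> \<in> Units R"
proof -
  have ef: "e \<in> carrier R" "f \<in> carrier R" "e \<otimes> e = e" "f \<otimes> f = f"
    using assms by (auto simp: idempotents_def)
  \<comment> \<open>Expanding without commutativity leaves ef and fe only in their sum, which the
    hypothesis replaces by e + f. Everything then collapses to 1, so the element is its own
    inverse.\<close>
  then have "(e \<oplus> f \<ominus> \<one>) \<otimes> (e \<oplus> f \<ominus> \<one>) =
      (e \<oplus> f) \<oplus> \<one> \<oplus> (e \<otimes> f \<oplus> f \<otimes> e) \<ominus> (e \<oplus> e) \<ominus> (f \<oplus> f)"
    by (algebra; simp add: a_ac)
  also have "\<dots> = \<one>"
    unfolding assms(3) using ef(1,2) by algebra
  finally show ?thesis
    using ef by (auto simp: Units_def)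
qed

lemma diff_idempotents_nilpotent:
  assumes "e \<in> idempotents R" "f \<in> idempotents R" "e \<otimes> f \<oplus> f \<otimes> e = e \<oplus> f"
  shows "e \<ominus> f \<in> nilpotents R"
proof -
  have ef: "e \<in> carrier R" "f \<in> carrier R" "e \<otimes> e = e" "f \<otimes> f = f"
    using assms by (auto simp: idempotents_def)
  \<comment> \<open>The mixed products again occur only as ef + fe, so the hypothesis makes the
    square vanish.\<close>
  then have "(e \<ominus> f) \<otimes> (e \<ominus> f) = (e \<oplus> f) \<ominus> (e \<otimes> f \<oplus> f \<otimes> e)"
    by algebra
  also have "\<dots> = \<zero>"
    unfolding assms(3) using ef(1,2) by algebra
  finally show ?thesis
    using ef by (intro nilpotentI_square_zero) auto
qed

text \<open>The off-diagonal Peirce components p = er(1 - e) and q = (1 - e)re square to zero, and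
  both e + p and e + q are idempotents satisfying the relation in \<open>unique\<close>. Hence p = q
  = 0, that is, er = ere = re.\<close>

lemma idempotent_central:
  assumes e: "e \<in> idempotents R"
    and unique: "\<And>f. \<lbrakk>f \<in> idempotents R; e \<otimes> f \<oplus> f \<otimes> e = e \<oplus> f\<rbrakk> \<Longrightarrow> f = e"
    and r: "r \<in> carrier R"
  shows "e \<otimes> r = r \<otimes> e"
proof -
  have ec: "e \<in> carrier R" "e \<otimes> e = e"
    using e by (auto simp: idempotents_def)
  define d where "d = \<one> \<ominus> e"
  have d: "d \<in> carrier R" "e \<otimes> d = \<zero>" "d \<otimes> e = \<zero>"
    unfolding d_def using ec by (simp, (algebra; simp)+)
  \<comment> \<open>Prefixed forms of the products of \<open>e\<close> and \<open>d\<close>, which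
    the simplifier can apply inside right-nested products.\<close>
  have ee: "e \<otimes> (e \<otimes> x) = e \<otimes> x" and ed: "e \<otimes> (d \<otimes> x) = \<zero>" and de: "d \<otimes> (e \<otimes> x) = \<zero>"
    if "x \<in> carrier R" for x
    using that ec d by (simp_all flip: m_assoc)
  define p where "p = e \<otimes> (r \<otimes> d)"
  have p: "p \<in> carrier R" "e \<otimes> p = p" "p \<otimes> e = \<zero>" "p \<otimes> p = \<zero>"
    unfolding p_def using ec d r by (auto simp: m_assoc ee de)
  have "(e \<oplus> p) \<otimes> (e \<oplus> p) = e \<oplus> p" "e \<otimes> (e \<oplus> p) \<oplus> (e \<oplus> p) \<otimes> e = e \<oplus> (e \<oplus> p)"
    using p ec by (simp_all add: l_distr r_distr a_ac)
  then have "e \<oplus> p = e"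
    using p(1) ec by (intro unique) (auto simp: idempotents_def)
  then have p0: "p = \<zero>"
    using p(1) ec(1) by simp
  define q where "q = d \<otimes> (r \<otimes> e)"
  have q: "q \<in> carrier R" "q \<otimes> e = q" "e \<otimes> q = \<zero>" "q \<otimes> q = \<zero>"
    unfolding q_def using ec d r by (auto simp: m_assoc ed)
  have "(e \<oplus> q) \<otimes> (e \<oplus> q) = e \<oplus> q" "e \<otimes> (e \<oplus> q) \<oplus> (e \<oplus> q) \<otimes> e = e \<oplus> (e \<oplus> q)"
    using q ec by (simp_all add: l_distr r_distr a_ac)
  then have "e \<oplus> q = e"
    using q(1) ec by (intro unique) (auto simp: idempotents_def)
  then have q0: "q = \<zero>"
    using q(1) ec(1) by simp
  have "e \<otimes> r \<ominus> e \<otimes> (r \<otimes> e) = p" "r \<otimes> e \<ominus> e \<otimes> (r \<otimes> e) = q"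
    unfolding p_def q_def d_def using ec r by ((algebra; simp)+)
  then show ?thesis
    using p0 q0 ec(1) r by (metis m_closed r_right_minus_eq)
qed

lemma CUC_idempotent_central:
  assumes "CUC_ring R" "e \<in> idempotents R" "r \<in> carrier R"
  shows "e \<otimes> r = r \<otimes> e"
proof (rule idempotent_central)
  fix f
  assume f: "f \<in> idempotents R" "e \<otimes> f \<oplus> f \<otimes> e = e \<oplus> f"
  have ec: "e \<in> carrier R" "e \<otimes> e = e" "f \<in> carrier R"
    using assms f by (auto simp: idempotents_def)
  \<comment> \<open>The case f = e of \<open>add_minus_one_unit\<close> says that 2e - 1 is a unit.
    It yields the decomposition of \<open>e\<close> with which the one coming from \<open>f\<close>
    is compared.\<close>
  have u: "e \<oplus> e \<ominus> \<one> \<in> Units R" "e \<oplus> f \<ominus> \<one> \<in> Units R"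
    using assms f ec by (auto intro: add_minus_one_unit)
  have i: "\<one> \<ominus> e \<in> idempotents R" "\<one> \<ominus> f \<in> idempotents R"
    using assms f by (auto intro: one_minus_idempotent)
  have "e = (e \<oplus> e \<ominus> \<one>) \<oplus> (\<one> \<ominus> e)" "e = (e \<oplus> f \<ominus> \<one>) \<oplus> (\<one> \<ominus> f)"
    using ec by algebra+
  moreover from this have "uniquely_clean R e"
    using uniquely_clean_if_CUC[OF assms(1) u(1) i(1)] by simp
  ultimately have "e \<oplus> e \<ominus> \<one> = e \<oplus> f \<ominus> \<one>"
    using uniquely_cleanD u i by blast
  then show "f = e"
    using ec by (auto simp: a_minus_def)
qed (use assms in auto)

lemma CUNC_idempotent_central:
  assumes "CUNC_ring R" "e \<in> idempotents R" "r \<in> carrier R"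
  shows "e \<otimes> r = r \<otimes> e"
proof (rule idempotent_central)
  fix f
  assume f: "f \<in> idempotents R" "e \<otimes> f \<oplus> f \<otimes> e = e \<oplus> f"
  have ec: "e \<in> carrier R" "e \<otimes> e = e" "f \<in> carrier R"
    using assms f by (auto simp: idempotents_def)
  \<comment> \<open>The decomposition e = (2e - 1) + (1 - e) only serves to show that
    \<open>e\<close> is clean; the comparison is between the nil-clean decompositions 0 + e and (e -
    f) + f.\<close>
  have "e \<oplus> e \<ominus> \<one> \<in> Units R" "\<one> \<ominus> e \<in> idempotents R"
    using assms ec by (auto intro: add_minus_one_unit one_minus_idempotent)
  moreover have "e = (e \<oplus> e \<ominus> \<one>) \<oplus> (\<one> \<ominus> e)" "e = \<zero> \<oplus> e" "e = (e \<ominus> f) \<oplus> f"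
    using ec by algebra+
  ultimately have "uniquely_nil_clean R e" "e = \<zero> \<oplus> e" "e = (e \<ominus> f) \<oplus> f"
    using uniquely_nil_clean_if_CUNC[OF assms(1)] by metis+
  then show "f = e"
    using uniquely_nil_cleanD(2) zero_nilpotent assms(2) f diff_idempotents_nilpotent by blast
qed (use assms in auto)

section \<open>Units obtained from nilpotents\<close>

lemma one_minus_pow_factor:
  assumes "t \<in> carrier R"
  shows "\<exists>s\<in>carrier R. (\<one> \<ominus> t) \<otimes> s = \<one> \<ominus> t [^] (n::nat) \<and> s \<otimes> (\<one> \<ominus> t) = \<one> \<ominus> t [^] n"
proof (induction n)
  case 0
  \<comment> \<open>The witness \<open>s\<close> is the geometric sum 1 + t + ... + t^(n-1), empty
    for n = 0; the induction step appends t^n.\<close>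
  show ?case
    using assms by (intro bexI[of _ \<zero>]) (auto simp: a_minus_def r_neg)
next
  case (Suc n)
  then obtain s where s: "s \<in> carrier R" "(\<one> \<ominus> t) \<otimes> s = \<one> \<ominus> t [^] n"
    "s \<otimes> (\<one> \<ominus> t) = \<one> \<ominus> t [^] n"
    by blast
  define a where "a = t [^] n"
  \<comment> \<open>Powers grow by a factor on the right, so the product with 1 - t on the left
    needs \<open>t\<close> to commute with t^n.\<close>
  have a: "a \<in> carrier R" "t \<otimes> a = a \<otimes> t"
    unfolding a_def using assms by (auto simp: nat_pow_comm[of t 1 n, simplified])
  have "(\<one> \<ominus> t) \<otimes> (s \<oplus> a) = (\<one> \<ominus> t) \<otimes> s \<oplus> (a \<ominus> t \<otimes> a)"
    using s(1) a(1) assms by (algebra; simp)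
  also have "\<dots> = \<one> \<ominus> a \<otimes> t"
    unfolding s a(2) a_def[symmetric] using a(1) assms by algebra
  finally have 1: "(\<one> \<ominus> t) \<otimes> (s \<oplus> a) = \<one> \<ominus> a \<otimes> t" .
  have "(s \<oplus> a) \<otimes> (\<one> \<ominus> t) = s \<otimes> (\<one> \<ominus> t) \<oplus> (a \<ominus> a \<otimes> t)"
    using s(1) a(1) assms by (algebra; simp)
  also have "\<dots> = \<one> \<ominus> a \<otimes> t"
    unfolding s a_def[symmetric] using a(1) assms by algebra
  finally have "(s \<oplus> a) \<otimes> (\<one> \<ominus> t) = \<one> \<ominus> a \<otimes> t" .
  with 1 show ?case
    using s(1) a(1) by (intro bexI[of _ "s \<oplus> a"]) (auto simp: a_def)
qed

lemma one_minus_nilpotent_unit: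
  assumes "t \<in> nilpotents R"
  shows "\<one> \<ominus> t \<in> Units R"
proof -
  obtain n :: nat where t: "t \<in> carrier R" "t [^] n = \<zero>"
    using assms by (auto simp: nilpotents_def)
  obtain s where "s \<in> carrier R" "(\<one> \<ominus> t) \<otimes> s = \<one>" "s \<otimes> (\<one> \<ominus> t) = \<one>"
    using one_minus_pow_factor[OF t(1), of n] t(2) by (auto simp: a_minus_def)
  then show ?thesis
    using t(1) by (auto simp: Units_def)
qed

lemma commuting_mult_nilpotent:
  assumes "v \<in> carrier R" "q \<in> nilpotents R" "v \<otimes> q = q \<otimes> v"
  shows "v \<otimes> q \<in> nilpotents R"
proof -
  obtain n :: nat where q: "q \<in> carrier R" "q [^] n = \<zero>"
    using assms by (auto simp: nilpotents_def)
  then have "(v \<otimes> q) [^] n = \<zero>"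
    using pow_mult_distrib[OF assms(3,1) q(1)] assms(1) by simp
  then show ?thesis
    using assms(1) q(1) by (auto simp: nilpotents_def)
qed

text \<open>Factor v - q = v(1 - v^(-1) q). Commutation with \<open>q\<close> passes from
  \<open>v\<close> to its inverse, so v^(-1) q is nilpotent and the second factor is a unit.\<close>

lemma unit_minus_nilpotent_unit:
  assumes v: "v \<in> Units R" and q: "q \<in> nilpotents R" and comm: "v \<otimes> q = q \<otimes> v"
  shows "v \<ominus> q \<in> Units R"
proof -
  have c: "v \<in> carrier R" "q \<in> carrier R" "inv v \<in> carrier R"
    using v q by (auto simp: nilpotents_carrier)
  have "inv v \<otimes> q = inv v \<otimes> (q \<otimes> v) \<otimes> inv v"
    using c v by (simp add: m_assoc)
  also have "\<dots> = q \<otimes> inv v"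
    using c v by (simp flip: comm m_assoc)
  finally have "inv v \<otimes> q \<in> nilpotents R"
    using c q by (intro commuting_mult_nilpotent)
  then have "v \<otimes> (\<one> \<ominus> inv v \<otimes> q) \<in> Units R"
    using v one_minus_nilpotent_unit by blast
  moreover have "v \<otimes> (\<one> \<ominus> inv v \<otimes> q) = v \<ominus> v \<otimes> inv v \<otimes> q"
    using c by (algebra; simp)
  ultimately show ?thesis
    using c v by simp
qed

lemma uminus_nilpotent:
  assumes "q \<in> nilpotents R"
  shows "\<ominus> q \<in> nilpotents R"
  using commuting_mult_nilpotent[of "\<ominus> \<one>" q] assms nilpotents_carrier[OF assms]
  by (simp add: l_minus r_minus)

lemma one_plus_nilpotent_unit:
  assumes "q \<in> nilpotents R"
  shows "\<one> \<oplus> q \<in> Units R"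
  using one_minus_nilpotent_unit[OF uminus_nilpotent[OF assms]] nilpotents_carrier[OF assms]
  by (simp add: a_minus_def)

section \<open>Left ideals and the Jacobson radical\<close>

lemma left_ideal_principal:
  assumes "a \<in> carrier R"
  shows "left_ideal ((\<lambda>x. x \<otimes> a) ` carrier R) R"
proof -
  have "subgroup ((\<lambda>x. x \<otimes> a) ` carrier R) (add_monoid R)"
  proof (rule add.subgroupI)
    show "(\<lambda>x. x \<otimes> a) ` carrier R \<subseteq> carrier R"
      using assms by auto
    show "(\<lambda>x. x \<otimes> a) ` carrier R \<noteq> {}"
      using assms by auto
    show "\<ominus> b \<in> (\<lambda>x. x \<otimes> a) ` carrier R" if "b \<in> (\<lambda>x. x \<otimes> a) ` carrier R" for b
      using that assms by (auto simp flip: l_minus)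
    show "b \<oplus> c \<in> (\<lambda>x. x \<otimes> a) ` carrier R"
      if "b \<in> (\<lambda>x. x \<otimes> a) ` carrier R" "c \<in> (\<lambda>x. x \<otimes> a) ` carrier R" for b c
      using that assms by (auto simp flip: l_distr)
  qed
  then show ?thesis
    using assms by (auto simp: left_ideal_def additive_subgroup_def simp flip: m_assoc)
qed

lemma left_ideal_eq_carrier:
  assumes "left_ideal I R" "\<one> \<in> I"
  shows "I = carrier R"
  using assms additive_subgroup.a_subset[of I R] by (force simp: left_ideal_def)

text \<open>Provides the upper bounds for Zorn's lemma. Closure under addition holds because two
  elements of the union already lie in one member of the chain.\<close>

lemma left_ideal_Union_chain:
  assumes "C \<noteq> {}" "subset.chain {I. left_ideal I R} C"
  shows "left_ideal (\<Union>C) R"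
proof -
  have I: "additive_subgroup I R" if "I \<in> C" for I
    using that assms(2) by (auto simp: subset.chain_def left_ideal_def)
  have "subgroup (\<Union>C) (add_monoid R)"
  proof (rule add.subgroupI)
    show "\<Union>C \<subseteq> carrier R"
      using I additive_subgroup.a_subset by blast
    show "\<Union>C \<noteq> {}"
      using I assms(1) additive_subgroup.zero_closed by blast
    show "\<ominus> b \<in> \<Union>C" if "b \<in> \<Union>C" for b
      using that I additive_subgroup.a_inv_closed[of _ R b] by auto
    show "b \<oplus> c \<in> \<Union>C" if "b \<in> \<Union>C" "c \<in> \<Union>C" for b c
    proof -
      obtain K where "K \<in> C" "b \<in> K" "c \<in> K"
        using \<open>b \<in> \<Union>C\<close> \<open>c \<in> \<Union>C\<close> assms(2) unfolding subset_chain_def by blast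
      then show ?thesis
        using I additive_subgroup.a_closed by fast
    qed
  qed
  then show ?thesis
    using assms(2) by (auto simp: left_ideal_def additive_subgroup_def subset.chain_def)
qed

text \<open>Zorn's lemma on the left ideals above \<open>I\<close> that avoid 1. For left ideals
  this is the same as being proper, but in this form it is visibly inherited by unions of
  chains.\<close>

lemma proper_left_ideal_in_maximal:
  assumes "left_ideal I R" "\<one> \<notin> I"
  obtains M where "maximal_left_ideal M R" "I \<subseteq> M"
proof -
  let ?A = "{K. left_ideal K R \<and> I \<subseteq> K \<and> \<one> \<notin> K}"
  have "\<exists>M\<in>?A. \<forall>K\<in>?A. M \<subseteq> K \<longrightarrow> K = M"
  proof (rule subset_Zorn_nonempty)
    show "?A \<noteq> {}"
      using assms by auto
    show "\<Union>C \<in> ?A" if "C \<noteq> {}" "subset.chain ?A C" for C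
    proof -
      have "left_ideal (\<Union>C) R"
        using that by (intro left_ideal_Union_chain) (auto simp: subset.chain_def)
      then show ?thesis
        using that by (auto simp: subset.chain_def)
    qed
  qed
  then obtain M where M: "M \<in> ?A" "\<forall>K\<in>?A. M \<subseteq> K \<longrightarrow> K = M" ..
  have "maximal_left_ideal M R"
    unfolding maximal_left_ideal_def
  proof (intro conjI allI impI)
    show "left_ideal M R" "M \<noteq> carrier R"
      using M(1) by auto
    show "K = M \<or> K = carrier R" if "left_ideal K R" "M \<subseteq> K" for K
    proof (cases "\<one> \<in> K")
      case True
      with that(1) show ?thesis
        by (simp add: left_ideal_eq_carrier)
    next
      case False
      with that M show ?thesis
        by auto
    qed
  qed
  moreover have "I \<subseteq> M"
    using M(1) by simp
  ultimately show ?thesis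
    by (rule that)
qed

lemma jacobson_radical_carrier: "j \<in> jacobson_radical R \<Longrightarrow> j \<in> carrier R"
  by (simp add: jacobson_radical_def)

lemma jacobson_radical_left_ideal: "left_ideal (jacobson_radical R) R"
proof -
  have M: "additive_subgroup M R" if "maximal_left_ideal M R" for M
    using that by (simp add: maximal_left_ideal_def left_ideal_def)
  have "subgroup (jacobson_radical R) (add_monoid R)"
  proof (rule add.subgroupI)
    show "jacobson_radical R \<subseteq> carrier R"
      by (auto simp: jacobson_radical_def)
    have "\<zero> \<in> jacobson_radical R"
      using M additive_subgroup.zero_closed by (fastforce simp: jacobson_radical_def)
    then show "jacobson_radical R \<noteq> {}"
      by auto
    show "\<ominus> b \<in> jacobson_radical R" if "b \<in> jacobson_radical R" for b
      using that M additive_subgroup.a_inv_closed[of _ R b]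
      by (auto simp: jacobson_radical_def)
    show "b \<oplus> c \<in> jacobson_radical R"
      if "b \<in> jacobson_radical R" "c \<in> jacobson_radical R" for b c
      using that M additive_subgroup.a_closed by (fastforce simp: jacobson_radical_def)
  qed
  then show ?thesis
    by (auto simp: left_ideal_def additive_subgroup_def jacobson_radical_def maximal_left_ideal_def)
qed

lemma jacobson_radical_add:
  "\<lbrakk>a \<in> jacobson_radical R; b \<in> jacobson_radical R\<rbrakk> \<Longrightarrow> a \<oplus> b \<in> jacobson_radical R"
  and jacobson_radical_mult:
  "\<lbrakk>x \<in> carrier R; a \<in> jacobson_radical R\<rbrakk> \<Longrightarrow> x \<otimes> a \<in> jacobson_radical R"
  and jacobson_radical_uminus:
  "a \<in> jacobson_radical R \<Longrightarrow> \<ominus> a \<in> jacobson_radical R"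
  using jacobson_radical_left_ideal additive_subgroup.a_closed
    additive_subgroup.a_inv_closed
  by (auto simp: left_ideal_def)

text \<open>Otherwise the left ideal R(1 + j) lies in a maximal left ideal. That ideal also contains
  \<open>j\<close>, hence 1, which is impossible.\<close>

lemma one_plus_jacobson_left_inverse:
  assumes "j \<in> jacobson_radical R"
  obtains x where "x \<in> carrier R" "x \<otimes> (\<one> \<oplus> j) = \<one>"
proof -
  have j: "j \<in> carrier R"
    using assms by (rule jacobson_radical_carrier)
  let ?I = "(\<lambda>x. x \<otimes> (\<one> \<oplus> j)) ` carrier R"
  have "\<one> \<in> ?I"
  proof (rule ccontr)
    assume "\<one> \<notin> ?I"
    then obtain M where M: "maximal_left_ideal M R" "?I \<subseteq> M"
      using proper_left_ideal_in_maximal left_ideal_principal j by (metis a_closed one_closed)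
    then have sub: "additive_subgroup M R" and "j \<in> M"
      using assms by (auto simp: maximal_left_ideal_def left_ideal_def jacobson_radical_def)
    have "\<one> \<otimes> (\<one> \<oplus> j) \<in> M"
      using M(2) by blast
    then have "\<one> \<oplus> j \<in> M"
      using j by simp
    then have "(\<one> \<oplus> j) \<oplus> \<ominus> j \<in> M"
      using sub \<open>j \<in> M\<close> additive_subgroup.a_closed
        additive_subgroup.a_inv_closed by metis
    moreover have "(\<one> \<oplus> j) \<oplus> \<ominus> j = \<one>"
      using j by algebra
    ultimately have "\<one> \<in> M"
      by simp
    then show False
      using M(1) left_ideal_eq_carrier by (auto simp: maximal_left_ideal_def)
  qed
  then show ?thesis
    using that by auto
qed

text \<open>A left inverse x of 1 + j equals 1 - xj, and xj is again in the radical, so x has a left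
  inverse y of its own. With the right inverse 1 + j this forces y = 1 + j, making the inverse
  two-sided.\<close>

lemma one_plus_jacobson_unit:
  assumes "j \<in> jacobson_radical R"
  shows "\<one> \<oplus> j \<in> Units R"
proof -
  have j: "j \<in> carrier R"
    using assms by (rule jacobson_radical_carrier)
  obtain x where x: "x \<in> carrier R" "x \<otimes> (\<one> \<oplus> j) = \<one>"
    using one_plus_jacobson_left_inverse assms by blast
  have "\<ominus> (x \<otimes> j) \<in> jacobson_radical R"
    using assms x jacobson_radical_mult jacobson_radical_uminus by blast
  then obtain y where y: "y \<in> carrier R" "y \<otimes> (\<one> \<oplus> \<ominus> (x \<otimes> j)) = \<one>"
    using one_plus_jacobson_left_inverse by blast
  have "\<one> \<oplus> \<ominus> (x \<otimes> j) = x \<otimes> (\<one> \<oplus> j) \<oplus> \<ominus> (x \<otimes> j)"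
    by (simp add: x(2))
  also have "\<dots> = x"
    using x(1) j by (algebra; simp)
  finally have yx: "y \<otimes> x = \<one>"
    using y by simp
  have "y = y \<otimes> (x \<otimes> (\<one> \<oplus> j))"
    using x y(1) by simp
  also have "\<dots> = \<one> \<oplus> j"
    using x(1) y(1) yx j by (simp flip: m_assoc)
  finally have "y = \<one> \<oplus> j" .
  then show ?thesis
    using x yx j by (auto simp: Units_def)
qed

section \<open>One-sided inverses and corners when idempotents are central\<close>

lemma central_idempotents_left_inverse_unit:
  assumes central: "\<And>e r. \<lbrakk>e \<in> idempotents R; r \<in> carrier R\<rbrakk> \<Longrightarrow> e \<otimes> r = r \<otimes> e"
    and x: "x \<in> carrier R" and y: "y \<in> carrier R" and yx: "y \<otimes> x = \<one>"
  shows "x \<in> Units R"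
proof -
  \<comment> \<open>Since yx = 1, the product xy is idempotent, hence central. Moving it past y in
    y(xy)x gives xy, while regrouping gives (yx)(yx) = 1.\<close>
  have "x \<otimes> y \<otimes> (x \<otimes> y) = x \<otimes> (y \<otimes> x) \<otimes> y"
    using x y by (simp add: m_assoc)
  then have "x \<otimes> y \<in> idempotents R"
    using x y yx by (simp add: idempotents_def)
  then have "x \<otimes> y \<otimes> y = y \<otimes> (x \<otimes> y)"
    using y by (rule central)
  then have "y \<otimes> (x \<otimes> y) \<otimes> x = x \<otimes> y \<otimes> (y \<otimes> x)"
    using x y by (metis m_assoc m_closed)
  moreover have "y \<otimes> (x \<otimes> y) \<otimes> x = (y \<otimes> x) \<otimes> (y \<otimes> x)"
    using x y by (simp add: m_assoc)
  ultimately have "x \<otimes> y = \<one>"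
    using x y yx by simp
  with yx show ?thesis
    using x y by (auto simp: Units_def)
qed

text \<open>Padding with 1 - e turns elements of the corner at \<open>e\<close> into elements of the
  whole ring. As \<open>b\<close> commutes with \<open>e\<close>, the cross terms ae(1 - e) and (1 -
  e)be vanish, so inverses in the corner become inverses in the ring.\<close>

lemma corner_mult:
  assumes "e \<in> idempotents R" "a \<in> carrier R" "b \<in> carrier R" "e \<otimes> b = b \<otimes> e"
  shows "(a \<otimes> e \<oplus> (\<one> \<ominus> e)) \<otimes> (b \<otimes> e \<oplus> (\<one> \<ominus> e)) = a \<otimes> b \<otimes> e \<oplus> (\<one> \<ominus> e)"
proof -
  define d where "d = \<one> \<ominus> e"
  have e: "e \<in> carrier R" "e \<otimes> e = e"
    using assms by (auto simp: idempotents_def)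
  have d: "d \<in> carrier R" "d \<otimes> d = d" "e \<otimes> d = \<zero>" "d \<otimes> e = \<zero>"
    unfolding d_def using e by (simp, (algebra; simp)+)
  have ebe: "e \<otimes> (b \<otimes> e) = b \<otimes> e" and dbe: "d \<otimes> (b \<otimes> e) = \<zero>"
    using e d assms by (simp_all flip: assms(4) m_assoc)
  have "(a \<otimes> e \<oplus> d) \<otimes> (b \<otimes> e \<oplus> d)
    = a \<otimes> (e \<otimes> (b \<otimes> e)) \<oplus> a \<otimes> (e \<otimes> d) \<oplus> (d \<otimes> (b \<otimes> e) \<oplus> d \<otimes> d)"
    using e(1) d(1) assms by algebra
  then have "(a \<otimes> e \<oplus> d) \<otimes> (b \<otimes> e \<oplus> d) = a \<otimes> b \<otimes> e \<oplus> d"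
    using assms e d by (simp add: ebe dbe m_assoc)
  then show ?thesis
    by (simp add: d_def)
qed

section \<open>From CUNC to CUC and a nil radical\<close>

lemma CUNC_unit_minus_one_nilpotent:
  assumes "CUNC_ring R" "u \<in> Units R"
  shows "u \<ominus> \<one> \<in> nilpotents R"
proof -
  \<comment> \<open>A unit is clean with idempotent 0.\<close>
  have "uniquely_nil_clean R (u \<oplus> \<zero>)"
    using assms zero_idempotent by (rule uniquely_nil_clean_if_CUNC)
  then obtain q e where qe: "q \<in> nilpotents R" "e \<in> idempotents R" "u = q \<oplus> e"
    using Units_closed[OF assms(2)] unfolding uniquely_nil_clean_def by (metis mem_Times_iff r_zero)
  have c: "q \<in> carrier R" "e \<in> carrier R" "e \<otimes> e = e" "u \<in> carrier R"
    using qe assms(2) by (auto simp: idempotents_def nilpotents_def)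
  \<comment> \<open>As \<open>e\<close> is central, u = q + e commutes with \<open>q\<close>. Then e
    = u - q is a unit, and the only idempotent unit is 1.\<close>
  have "u \<otimes> q = q \<otimes> u"
    using c qe(3) CUNC_idempotent_central[OF assms(1) qe(2) c(1)] by (simp add: l_distr r_distr)
  then have "u \<ominus> q \<in> Units R"
    using assms(2) qe(1) by (intro unit_minus_nilpotent_unit)
  moreover have "u \<ominus> q = e"
    unfolding qe(3) using c(1,2) by algebra
  ultimately have "e \<in> Units R"
    by simp
  then have "e = \<one>"
    using c(2,3) Units_l_cancel[of e e \<one>] by simp
  then have "u \<ominus> \<one> = q"
    unfolding qe(3) using c(1) by (simp, algebra)
  with qe(1) show ?thesis
    by simp
qed

lemma CUNC_jacobson_radical_nil:
  assumes "CUNC_ring R"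
  shows "nil_subset (jacobson_radical R) R"
  unfolding nil_subset_def
proof
  fix j
  assume j: "j \<in> jacobson_radical R"
  then have "\<one> \<oplus> j \<ominus> \<one> \<in> nilpotents R"
    using CUNC_unit_minus_one_nilpotent[OF assms] one_plus_jacobson_unit by blast
  moreover have "\<one> \<oplus> j \<ominus> \<one> = j"
    using jacobson_radical_carrier[OF j] by algebra
  ultimately show "j \<in> nilpotents R"
    by simp
qed

lemma CUNC_imp_CUC:
  assumes "CUNC_ring R"
  shows "CUC_ring R"
  unfolding CUC_ring_def
proof (intro conjI ballI impI)
  show "ring R"
    by (rule ring_axioms)
  fix r
  assume r: "r \<in> carrier R" and "clean R r"
  from \<open>clean R r\<close> show "uniquely_clean R r"
  proof (rule uniquely_cleanI)
    fix u e v f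
    assume ue: "u \<in> Units R" "e \<in> idempotents R" "r = u \<oplus> e"
      and vf: "v \<in> Units R" "f \<in> idempotents R" "r = v \<oplus> f"
    have c: "u \<in> carrier R" "e \<in> carrier R" "v \<in> carrier R" "f \<in> carrier R" "e \<otimes> e = e"
      using ue vf by (auto simp: idempotents_def)
    have nil: "u \<ominus> \<one> \<in> nilpotents R" "v \<ominus> \<one> \<in> nilpotents R"
      using assms ue vf CUNC_unit_minus_one_nilpotent by auto
    have "u \<oplus> e \<ominus> \<one> = (u \<ominus> \<one>) \<oplus> e" "v \<oplus> f \<ominus> \<one> = (v \<ominus> \<one>) \<oplus> f"
      using c by algebra+
    then have eq: "r \<ominus> \<one> = (u \<ominus> \<one>) \<oplus> e" "r \<ominus> \<one> = (v \<ominus> \<one>) \<oplus> f"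
      by (simp_all flip: ue(3) vf(3))
    \<comment> \<open>CUNC gives uniqueness at r - 1 only once r - 1 is known to be clean. The
      decomposition used is r - 1 = ((2e - 1) - (1 - u)) + (1 - e), whose first summand is a unit
      minus a commuting nilpotent.\<close>
    have inv: "e \<oplus> e \<ominus> \<one> \<in> Units R"
      using ue c by (intro add_minus_one_unit) auto
    have "(e \<oplus> e \<ominus> \<one>) \<otimes> (\<one> \<ominus> u) = (\<one> \<ominus> u) \<otimes> (e \<oplus> e \<ominus> \<one>)"
      using c CUNC_idempotent_central[OF assms ue(2), of u]
      by (simp add: a_minus_def l_distr r_distr l_minus r_minus minus_add a_ac)
    moreover have neg: "\<one> \<ominus> u = \<ominus> (u \<ominus> \<one>)"
      using c by algebra
    ultimately have "(e \<oplus> e \<ominus> \<one>) \<ominus> (\<one> \<ominus> u) \<in> Units R"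
      using unit_minus_nilpotent_unit[OF inv] uminus_nilpotent[OF nil(1)] by metis
    then have "uniquely_nil_clean R ((e \<oplus> e \<ominus> \<one>) \<ominus> (\<one> \<ominus> u) \<oplus> (\<one> \<ominus> e))"
      using assms ue(2) one_minus_idempotent by (intro uniquely_nil_clean_if_CUNC)
    moreover have "(e \<oplus> e \<ominus> \<one>) \<ominus> (\<one> \<ominus> u) \<oplus> (\<one> \<ominus> e) = r \<ominus> \<one>"
      unfolding ue(3) using c by algebra
    ultimately show "e = f"
      using uniquely_nil_cleanD(2) nil eq ue(2) vf(2) by metis
  qed
qed

section \<open>From CUC and a nil radical to CUNC in semipotent rings\<close>

lemma CUC_unit_one_minus_in_jacobson_radical:
  assumes "semipotent_ring R" "CUC_ring R" "u \<in> Units R"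
  shows "\<one> \<ominus> u \<in> jacobson_radical R"
proof (rule ccontr)
  assume notin: "\<one> \<ominus> u \<notin> jacobson_radical R"
  define a where "a = \<one> \<ominus> u"
  have c: "u \<in> carrier R" "inv u \<in> carrier R" "a \<in> carrier R"
    using assms(3) by (auto simp: a_def)
  let ?I = "(\<lambda>x. x \<otimes> a) ` carrier R"
  have "a \<in> ?I"
    using c l_one by (metis image_eqI one_closed)
  then have "\<not> ?I \<subseteq> jacobson_radical R"
    using notin a_def by blast
  then obtain e where e: "e \<in> idempotents R" "e \<in> ?I" "e \<noteq> \<zero>"
    using assms(1) left_ideal_principal[OF c(3)] unfolding semipotent_ring_def by blast
  then obtain r where r: "r \<in> carrier R" "e = r \<otimes> a"
    by auto
  have ec: "e \<in> carrier R" "e \<otimes> e = e"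
    using e(1) by (auto simp: idempotents_def)
  note central = CUC_idempotent_central[OF assms(2)]
  \<comment> \<open>On the corner at \<open>e\<close>, \<open>x\<close> acts as u - 1 = -a and
    \<open>y\<close> as -r. The sign in \<open>x\<close> makes x + e agree with \<open>w\<close>
    below, and the two signs cancel in yx because ra = e. A left inverse suffices, since idempotents
    are central.\<close>
  define x where "x = (\<ominus> a) \<otimes> e \<oplus> (\<one> \<ominus> e)"
  define y where "y = (\<ominus> r) \<otimes> e \<oplus> (\<one> \<ominus> e)"
  have xy: "x \<in> carrier R" "y \<in> carrier R"
    using c r ec by (auto simp: x_def y_def)
  have "y \<otimes> x = (\<ominus> r) \<otimes> (\<ominus> a) \<otimes> e \<oplus> (\<one> \<ominus> e)"
    unfolding x_def y_def using c r e(1) central by (intro corner_mult) auto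
  also have "(\<ominus> r) \<otimes> (\<ominus> a) = e"
    using c r by (simp add: l_minus r_minus)
  also have "e \<otimes> e \<oplus> (\<one> \<ominus> e) = \<one>"
    unfolding ec(2) using ec(1) by algebra
  finally have x_unit: "x \<in> Units R"
    using central xy by (intro central_idempotents_left_inverse_unit[of x y])
  \<comment> \<open>\<open>w\<close> is \<open>u\<close> on the corner and the identity on its
    complement; \<open>z\<close> does the same with the inverse of \<open>u\<close>.\<close>
  define w where "w = u \<otimes> e \<oplus> (\<one> \<ominus> e)"
  define z where "z = inv u \<otimes> e \<oplus> (\<one> \<ominus> e)"
  have wz: "w \<in> carrier R" "z \<in> carrier R"
    using c ec by (auto simp: w_def z_def)
  have "z \<otimes> w = inv u \<otimes> u \<otimes> e \<oplus> (\<one> \<ominus> e)"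
    unfolding w_def z_def using c e(1) central by (intro corner_mult) auto
  also have "\<dots> = e \<oplus> (\<one> \<ominus> e)"
    using assms(3) ec by simp
  also have "\<dots> = \<one>"
    using ec(1) by algebra
  finally have w_unit: "w \<in> Units R"
    using central wz by (intro central_idempotents_left_inverse_unit[of w z])
  \<comment> \<open>Two clean decompositions of \<open>w\<close>, with idempotents 0 and
    \<open>e\<close>.\<close>
  have "w = w \<oplus> \<zero>"
    using wz by simp
  moreover have "w = x \<oplus> e"
    unfolding w_def x_def a_def using c ec(1) by (algebra; simp)
  moreover have "uniquely_clean R w"
    using uniquely_clean_if_CUC[OF assms(2) w_unit zero_idempotent] wz by simp
  ultimately have "\<zero> = e"
    using uniquely_cleanD(2) w_unit x_unit zero_idempotent e(1) by blast
  with e(3) show False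
    by simp
qed

lemma CUC_jacobson_radical_nil_imp_CUNC:
  assumes "semipotent_ring R" "CUC_ring R" "nil_subset (jacobson_radical R) R"
  shows "CUNC_ring R"
  unfolding CUNC_ring_def
proof (intro conjI ballI impI)
  show "ring R"
    by (rule ring_axioms)
  fix r
  assume "r \<in> carrier R" and "clean R r"
  then obtain u e where ue: "u \<in> Units R" "e \<in> idempotents R" "r = u \<oplus> e"
    by (auto simp: clean_def)
  have c: "u \<in> carrier R" "e \<in> carrier R"
    using ue by (auto simp: idempotents_carrier)
  note J = CUC_unit_one_minus_in_jacobson_radical[OF assms(1,2)]
  \<comment> \<open>As -1 is a unit, the radical contains 1 - (-1) = 2 and thus its left multiple
    2e.\<close>
  have "\<ominus> \<one> \<in> Units R"
    by (rule Units_minus_one_closed)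
  then have "e \<otimes> (\<one> \<ominus> \<ominus> \<one>) \<oplus> \<ominus> (\<one> \<ominus> u) \<in> jacobson_radical R"
    by (intro jacobson_radical_add jacobson_radical_mult jacobson_radical_uminus J c(2) ue(1))
  moreover have "e \<otimes> (\<one> \<ominus> \<ominus> \<one>) \<oplus> \<ominus> (\<one> \<ominus> u) = (e \<oplus> e) \<oplus> (u \<ominus> \<one>)"
    using c by (algebra; simp)
  ultimately have nil: "(e \<oplus> e) \<oplus> (u \<ominus> \<one>) \<in> nilpotents R"
    using assms(3) by (auto simp: nil_subset_def)
  have idem: "\<one> \<ominus> e \<in> idempotents R"
    using ue(2) by (rule one_minus_idempotent)
  have dec: "r = (e \<oplus> e) \<oplus> (u \<ominus> \<one>) \<oplus> (\<one> \<ominus> e)"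
    unfolding ue(3) using c by algebra
  from nil idem dec show "uniquely_nil_clean R r"
  proof (rule uniquely_nil_cleanI)
    fix p f
    assume pf: "p \<in> nilpotents R" "f \<in> idempotents R" "r = p \<oplus> f"
    let ?q = "(e \<oplus> e) \<oplus> (u \<ominus> \<one>)"
    \<comment> \<open>The shift by 1 replaces the nilpotent parts by units, giving two clean
      decompositions of 1 + r to which CUC applies.\<close>
    have units: "\<one> \<oplus> p \<in> Units R" "\<one> \<oplus> ?q \<in> Units R"
      using pf(1) nil one_plus_nilpotent_unit by auto
    have pc: "p \<in> carrier R" "f \<in> carrier R" "?q \<in> carrier R" "\<one> \<ominus> e \<in> carrier R"
      using pf c by (auto simp: nilpotents_carrier idempotents_carrier)
    have "\<one> \<oplus> r = (\<one> \<oplus> p) \<oplus> f" "\<one> \<oplus> r = (\<one> \<oplus> ?q) \<oplus> (\<one> \<ominus> e)"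
      using pf(3) dec pc a_assoc one_closed by metis+
    moreover from this have "uniquely_clean R (\<one> \<oplus> r)"
      using uniquely_clean_if_CUC[OF assms(2) units(1) pf(2)] by simp
    ultimately show "f = \<one> \<ominus> e"
      using uniquely_cleanD(2) units pf(2) idem by blast
  qed
qed

end

theorem proposition3p9:
  fixes R :: "('a, 'b) ring_scheme"
  assumes "ring R" and "semipotent_ring R"
  shows "CUNC_ring R \<longleftrightarrow> CUC_ring R \<and> nil_subset (jacobson_radical R) R"
  using ring.CUNC_imp_CUC[OF assms(1)] ring.CUNC_jacobson_radical_nil[OF assms(1)]
    ring.CUC_jacobson_radical_nil_imp_CUNC[OF assms] by blast

end
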